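(* Let $A\subset C$ and $B\subset D$ be unital inclusions of unital $C^*$-algebras which are strongly Morita equivalent with respect to a $C$-$D$-equivalence bimodule $Y$ and its closed subspace $X$. Let $\phi\in{}_B\mathbf{B}_B(D,B)$ be an element for which there is a quasi-basis. Then there is a quasi-basis for $f_{[X,Y]}(\phi)\in{}_A\mathbf{B}_A(C,A)$, and there is an isomorphism $\rho$ of the $C^*$-algebra $B'\cap D$ onto the $C^*$-algebra $A'\cap C$ such that $$\theta^{f_{[X,Y]}(\phi)}=\rho\circ\theta^{\phi}\circ\rho^{-1}.$$
   Context: For an inclusion $A\subset C$, ${}_A\mathbf{B}_A(C,A)$ is the space of bounded linear maps $\psi:C\to A$ with $\psi(ac)=a\psi(c)$ and $\psi(ca)=\psi(c)a$ for $a\in A$, $c\in C$; similarly ${}_B\mathbf{B}_B(D,B)$. Strong Morita equivalence of inclusions: $A\subset C$ and $B\subset D$ are strongly Morita equivalent with respect to a $C$-$D$-equivalence (imprimitivity) bimodule $Y$ (left $C$-valued inner product ${}_C\langle\cdot,\cdot\rangle$, right $D$-valued inner product $\langle\cdot,\cdot\rangle_D$) and its closed subspace $X$ if (i) $a\cdot x\in X$, $x\cdot b\in X$, ${}_C\langle x,z\rangle\in A$, $\langle x,z\rangle_D\in B$ for all $a\in A$, $b\in B$, $x,z\in X$; (ii) the closed linear spans of ${}_C\langle X,X\rangle$, $\langle X,X\rangle_D$, ${}_C\langle Y,X\rangle$, $\langle Y,X\rangle_D$ are $A$, $B$, $C$, $D$ respectively. Then $X$ is an $A$-$B$-equivalence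 bimodule with the restricted actions and inner products, written ${}_A\langle\cdot,\cdot\rangle$ and $\langle\cdot,\cdot\rangle_B$. The map $f_{[X,Y]}=f_{(X,Y)}:{}_B\mathbf{B}_B(D,B)\to{}_A\mathbf{B}_A(C,A)$: for $\phi\in{}_B\mathbf{B}_B(D,B)$ there is a unique linear map $\tau:Y\to X$ with $\langle x,\tau(y)\rangle_B=\phi(\langle x,y\rangle_D)$ for all $x\in X$, $y\in Y$, and a unique linear map $\psi:C\to A$ with $\psi(c)\cdot x=\tau(c\cdot x)$ for all $c\in C$, $x\in X$; $\psi$ lies in ${}_A\mathbf{B}_A(C,A)$ and $f_{[X,Y]}(\phi)=\psi$. A quasi-basis for $\phi\in{}_B\mathbf{B}_B(D,B)$ is a finite set $\{(u_i,v_i)\}_{i=1}^m\subset D\times D$ with $d=\sum_i u_i\phi(v_id)=\sum_i\phi(du_i)v_i$ for all $d\in D$. Modular automorphism: if $\phi\in{}_B\mathbf{B}_B(D,B)$ has a quasi-basis, $\theta^\phi$ denotes the unique (algebra) automorphism $\theta$ of the relative commutant $B'\cap D$ with $\phi(xy)=\phi(y\theta(x))$ for all $x\in B'\cap D$, $y\in D$ (existence and uniqueness are due to Watatani; explicitly $\theta^\phi(d)=\sum_iu_i\phi(dv_i)$ for any quasi-basis $\{(u_i,v_i)\}$). The same definitions apply to $A\subset C$. *)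

theory Defs
  imports "HOL-Analysis.Analysis"
begin

section \<open>Complex normed spaces and unital C*-algebras\<close>

class complex_normed_vector = real_normed_vector +
  fixes scaleC :: "complex \<Rightarrow> 'a \<Rightarrow> 'a"  (infixr "*\<^sub>C" 75)
  assumes scaleR_scaleC: "r *\<^sub>R x = complex_of_real r *\<^sub>C x"
    and scaleC_add_right: "a *\<^sub>C (x + y) = a *\<^sub>C x + a *\<^sub>C y"
    and scaleC_add_left: "(a + b) *\<^sub>C x = a *\<^sub>C x + b *\<^sub>C x"
    and scaleC_scaleC: "a *\<^sub>C b *\<^sub>C x = (a * b) *\<^sub>C x"
    and norm_scaleC: "norm (a *\<^sub>C x) = cmod a * norm x"

global_interpretation complex_vector:
  vector_space "scaleC :: complex \<Rightarrow> 'a \<Rightarrow> 'a::complex_normed_vector"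
  defines csubspace = complex_vector.subspace
    and cspan = complex_vector.span
proof
  fix x :: 'a
  show "1 *\<^sub>C x = x"
    using scaleR_scaleC[of 1 x] by simp
qed (simp_all add: scaleC_add_right scaleC_add_left scaleC_scaleC)

abbreviation clinear :: "('a::complex_normed_vector \<Rightarrow> 'b::complex_normed_vector) \<Rightarrow> bool" where
  "clinear \<equiv> Vector_Spaces.linear scaleC scaleC"

text \<open>The zero algebra is not excluded: \<open>monoid_mult\<close> provides the unit without \<open>0 \<noteq> 1\<close>.\<close>

class unital_cstar_algebra = complex_normed_vector + banach + real_normed_algebra + monoid_mult +
  fixes star :: "'a \<Rightarrow> 'a"
  assumes scaleC_mult_left: "(a *\<^sub>C x) * y = a *\<^sub>C (x * y)"
    and scaleC_mult_right: "x * (a *\<^sub>C y) = a *\<^sub>C (x * y)"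
    and star_add: "star (x + y) = star x + star y"
    and star_scaleC: "star (a *\<^sub>C x) = cnj a *\<^sub>C star x"
    and star_mult: "star (x * y) = star y * star x"
    and star_star: "star (star x) = x"
    and cstar_identity: "norm (star x * x) = (norm x)\<^sup>2"

definition positive_element :: "'a::unital_cstar_algebra \<Rightarrow> bool" where
  "positive_element a \<longleftrightarrow> (\<exists>b. a = star b * b)"

text \<open>An inclusion \<open>A \<subset> C\<close> is a subset \<open>A\<close> of a type \<open>'c\<close> that represents \<open>C\<close>; it is unital
  when \<open>A\<close> contains the unit of \<open>C\<close>.\<close>

definition unital_cstar_subalgebra :: "'a::unital_cstar_algebra set \<Rightarrow> bool" where
  "unital_cstar_subalgebra A \<longleftrightarrow>
     csubspace A \<and> closed A \<and> 1 \<in> A \<and>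
     (\<forall>a\<in>A. \<forall>b\<in>A. a * b \<in> A) \<and> (\<forall>a\<in>A. star a \<in> A)"

definition relative_commutant :: "'a::unital_cstar_algebra set \<Rightarrow> 'a set" where
  "relative_commutant A = {c. \<forall>a\<in>A. a * c = c * a}"

definition algebra_iso_on ::
  "'a::unital_cstar_algebra set \<Rightarrow> 'b::unital_cstar_algebra set \<Rightarrow> ('a \<Rightarrow> 'b) \<Rightarrow> bool" where
  "algebra_iso_on S T h \<longleftrightarrow>
     bij_betw h S T \<and>
     (\<forall>x\<in>S. \<forall>y\<in>S. h (x + y) = h x + h y) \<and>
     (\<forall>a. \<forall>x\<in>S. h (a *\<^sub>C x) = a *\<^sub>C h x) \<and>
     (\<forall>x\<in>S. \<forall>y\<in>S. h (x * y) = h x * h y)"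

definition cstar_iso_on ::
  "'a::unital_cstar_algebra set \<Rightarrow> 'b::unital_cstar_algebra set \<Rightarrow> ('a \<Rightarrow> 'b) \<Rightarrow> bool" where
  "cstar_iso_on S T h \<longleftrightarrow> algebra_iso_on S T h \<and> (\<forall>x\<in>S. h (star x) = star (h x))"


section \<open>Bimodule maps, quasi-bases and modular automorphisms\<close>

definition bimodule_maps :: "'a::unital_cstar_algebra set \<Rightarrow> ('a \<Rightarrow> 'a) set" where
  "bimodule_maps A =
     {\<psi>. clinear \<psi> \<and> bounded_linear \<psi> \<and> range \<psi> \<subseteq> A \<and>
         (\<forall>a\<in>A. \<forall>c. \<psi> (a * c) = a * \<psi> c \<and> \<psi> (c * a) = \<psi> c * a)}"

definition quasi_basis ::
  "('a::unital_cstar_algebra \<Rightarrow> 'a) \<Rightarrow> nat \<Rightarrow> (nat \<Rightarrow> 'a) \<Rightarrow> (nat \<Rightarrow> 'a) \<Rightarrow> bool" where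
  "quasi_basis \<phi> m u v \<longleftrightarrow>
     (\<forall>d. d = (\<Sum>i=1..m. u i * \<phi> (v i * d)) \<and> d = (\<Sum>i=1..m. \<phi> (d * u i) * v i))"

text \<open>The automorphism lives on the relative commutant only; membership in \<open>extensional\<close> fixes
  its values elsewhere, so that the definite description can be unique.\<close>

definition modular_automorphism ::
  "'a::unital_cstar_algebra set \<Rightarrow> ('a \<Rightarrow> 'a) \<Rightarrow> 'a \<Rightarrow> 'a" where
  "modular_automorphism B \<phi> =
     (THE \<theta>. \<theta> \<in> extensional (relative_commutant B) \<and>
            algebra_iso_on (relative_commutant B) (relative_commutant B) \<theta> \<and>
            (\<forall>x\<in>relative_commutant B. \<forall>y. \<phi> (x * y) = \<phi> (y * \<theta> x)))"


section \<open>Equivalence bimodules and strong Morita equivalence of inclusions\<close>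

text \<open>A full left Hilbert \<open>C\<close>-module and full right Hilbert \<open>D\<close>-module with compatible structures.
  The left and right inner products of an equivalence bimodule always induce the same norm;
  that norm is the one of the Banach space \<open>'y\<close>, so both Hilbert module structures are complete.\<close>

locale equivalence_bimodule =
  fixes lact :: "'c::unital_cstar_algebra \<Rightarrow> 'y::{complex_normed_vector,banach} \<Rightarrow> 'y"
    and ract :: "'y \<Rightarrow> 'd::unital_cstar_algebra \<Rightarrow> 'y"
    and lip :: "'y \<Rightarrow> 'y \<Rightarrow> 'c"
    and rip :: "'y \<Rightarrow> 'y \<Rightarrow> 'd"
  assumes lact_add_right: "lact c (y + z) = lact c y + lact c z"
    and lact_add_left: "lact (c + c') y = lact c y + lact c' y"
    and lact_scaleC_right: "lact c (a *\<^sub>C y) = a *\<^sub>C lact c y"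
    and lact_scaleC_left: "lact (a *\<^sub>C c) y = a *\<^sub>C lact c y"
    and lact_mult: "lact (c * c') y = lact c (lact c' y)"
    and lact_one: "lact 1 y = y"
    and ract_add_left: "ract (y + z) d = ract y d + ract z d"
    and ract_add_right: "ract y (d + d') = ract y d + ract y d'"
    and ract_scaleC_left: "ract (a *\<^sub>C y) d = a *\<^sub>C ract y d"
    and ract_scaleC_right: "ract y (a *\<^sub>C d) = a *\<^sub>C ract y d"
    and ract_mult: "ract y (d * d') = ract (ract y d) d'"
    and ract_one: "ract y 1 = y"
    and lact_ract: "ract (lact c y) d = lact c (ract y d)"
    and lip_add_left: "lip (y + y') z = lip y z + lip y' z"
    and lip_lact: "lip (lact c y) z = c * lip y z"
    and lip_scaleC_left: "lip (a *\<^sub>C y) z = a *\<^sub>C lip y z"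
    and lip_star: "star (lip y z) = lip z y"
    and lip_positive: "positive_element (lip y y)"
    and lip_norm: "norm (lip y y) = (norm y)\<^sup>2"
    and lip_full: "closure (cspan {lip y z |y z. True}) = UNIV"
    and rip_add_right: "rip y (z + z') = rip y z + rip y z'"
    and rip_ract: "rip y (ract z d) = rip y z * d"
    and rip_scaleC_right: "rip y (a *\<^sub>C z) = a *\<^sub>C rip y z"
    and rip_star: "star (rip y z) = rip z y"
    and rip_positive: "positive_element (rip y y)"
    and rip_norm: "norm (rip y y) = (norm y)\<^sup>2"
    and rip_full: "closure (cspan {rip y z |y z. True}) = UNIV"
    and rip_lact: "rip (lact c y) z = rip y (lact (star c) z)"
    and lip_ract: "lip (ract y d) z = lip y (ract z (star d))"
    and lip_rip: "lact (lip x y) z = ract x (rip y z)"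

definition strongly_Morita_equivalent_wrt ::
  "'c::unital_cstar_algebra set \<Rightarrow> 'd::unital_cstar_algebra set \<Rightarrow>
   ('c \<Rightarrow> 'y \<Rightarrow> 'y) \<Rightarrow> ('y \<Rightarrow> 'd \<Rightarrow> 'y) \<Rightarrow> ('y \<Rightarrow> 'y \<Rightarrow> 'c) \<Rightarrow> ('y \<Rightarrow> 'y \<Rightarrow> 'd) \<Rightarrow>
   'y::{complex_normed_vector,banach} set \<Rightarrow> bool" where
  "strongly_Morita_equivalent_wrt A B lact ract lip rip X \<longleftrightarrow>
     equivalence_bimodule lact ract lip rip \<and>
     csubspace X \<and> closed X \<and>
     (\<forall>a\<in>A. \<forall>x\<in>X. lact a x \<in> X) \<and>
     (\<forall>b\<in>B. \<forall>x\<in>X. ract x b \<in> X) \<and>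
     (\<forall>x\<in>X. \<forall>z\<in>X. lip x z \<in> A \<and> rip x z \<in> B) \<and>
     closure (cspan {lip x z |x z. x \<in> X \<and> z \<in> X}) = A \<and>
     closure (cspan {rip x z |x z. x \<in> X \<and> z \<in> X}) = B \<and>
     closure (cspan {lip y x |y x. x \<in> X}) = UNIV \<and>
     closure (cspan {rip y x |y x. x \<in> X}) = UNIV"

definition tau_map ::
  "('y \<Rightarrow> 'y \<Rightarrow> 'd::unital_cstar_algebra) \<Rightarrow> 'y::{complex_normed_vector,banach} set \<Rightarrow>
   ('d \<Rightarrow> 'd) \<Rightarrow> 'y \<Rightarrow> 'y" where
  "tau_map rip X \<phi> =
     (THE \<tau>. clinear \<tau> \<and> range \<tau> \<subseteq> X \<and> (\<forall>x\<in>X. \<forall>y. rip x (\<tau> y) = \<phi> (rip x y)))"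

definition f_map ::
  "'c::unital_cstar_algebra set \<Rightarrow> ('c \<Rightarrow> 'y \<Rightarrow> 'y) \<Rightarrow>
   ('y \<Rightarrow> 'y \<Rightarrow> 'd::unital_cstar_algebra) \<Rightarrow> 'y::{complex_normed_vector,banach} set \<Rightarrow>
   ('d \<Rightarrow> 'd) \<Rightarrow> 'c \<Rightarrow> 'c" where
  "f_map A lact rip X \<phi> =
     (THE \<psi>. clinear \<psi> \<and> range \<psi> \<subseteq> A \<and>
            (\<forall>c. \<forall>x\<in>X. lact (\<psi> c) x = tau_map rip X \<phi> (lact c x)))"

end

theory Submission
  imports Defs
begin

text \<open>
  The units make everything finite. The linear span of the inner products \<open>lip x z\<close> with
  \<open>x, z \<in> X\<close> is a dense left ideal of \<open>A\<close>, so it contains \<open>1\<close>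
  (\<open>one_in_dense_left_ideal\<close>): there are \<open>x\<^sub>i, z\<^sub>i \<in> X\<close> with \<open>\<Sum>\<^sub>i lip x\<^sub>i z\<^sub>i = 1\<close>, and
  likewise \<open>x'\<^sub>j, z'\<^sub>j \<in> X\<close> with \<open>\<Sum>\<^sub>j rip x'\<^sub>j z'\<^sub>j = 1\<close>. Consequently
  \<open>y = \<Sum>\<^sub>i x\<^sub>i rip z\<^sub>i y\<close> for all \<open>y \<in> Y\<close>, and \<open>X\<close> is faithful for both \<open>C\<close> and \<open>D\<close>: an
  identity in \<open>C\<close> or \<open>D\<close> need only be tested on vectors of \<open>X\<close>. The frames give the explicit
  formulas \<open>\<tau> y = \<Sum>\<^sub>i x\<^sub>i \<phi> (rip z\<^sub>i y)\<close> and \<open>\<psi> c = \<Sum>\<^sub>i lip (\<tau> (c x\<^sub>i)) z\<^sub>i\<close> for the maps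
  that determine \<open>f_map\<close>, from which linearity, boundedness and the bimodule property
  follow, and they transport a quasi-basis of \<open>\<phi>\<close> to one of \<open>\<psi>\<close>
  (\<open>psi_quasi_basis\<close>).

  The isomorphism \<open>\<rho>\<close> sends \<open>d \<in> B' \<inter> D\<close> to the unique \<open>\<rho> d \<in> C\<close> whose left action on \<open>X\<close>
  is right multiplication by \<open>d\<close>. For \<open>x, w \<in> X\<close>, \<open>y = c x\<close> and \<open>\<theta> = \<theta>\<^sup>\<phi>\<close>,
  \<open>rip w (\<psi> (\<rho> d c) x) = \<phi> (d rip w y) = \<phi> (rip w y \<theta> d) = rip w (\<psi> (c \<rho> (\<theta> d)) x)\<close>,
  so \<open>\<psi> (\<rho> d c) = \<psi> (c \<rho> (\<theta> d))\<close> (\<open>psi_modular\<close>). A quasi-basis of \<open>\<psi>\<close> makes the form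
  \<open>(c, c') \<mapsto> \<psi> (c c')\<close> nondegenerate, and this identity therefore says that the modular
  automorphism of \<open>\<psi>\<close> maps \<open>\<rho> d\<close> to \<open>\<rho> (\<theta> d)\<close>.
\<close>

section \<open>Complex-linear maps and unital C*-algebras\<close>

lemma clinear_iff:
  "clinear f \<longleftrightarrow> (\<forall>x y. f (x + y) = f x + f y) \<and> (\<forall>a x. f (a *\<^sub>C x) = a *\<^sub>C f x)"
  by (simp add: Vector_Spaces.linear_iff complex_vector.vector_space_axioms)

lemma clinear_additive: "clinear f \<Longrightarrow> Modules.additive f"
  by (simp add: clinear_iff Modules.additive.intro)

lemma scaleC_sum: "a *\<^sub>C (\<Sum>i\<in>I. f i) = (\<Sum>i\<in>I. a *\<^sub>C f i)"
  by (rule complex_vector.scale_sum_right)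

lemma norm_star: "norm (star x) = norm (x :: 'a::unital_cstar_algebra)"
proof -
  have le: "norm y \<le> norm (star y)" for y :: 'a
  proof (cases "y = 0")
    case False
    have "norm y * norm y \<le> norm (star y) * norm y"
      using norm_mult_ineq[of "star y" y] by (simp add: cstar_identity power2_eq_square)
    with False show ?thesis by simp
  qed simp
  show ?thesis using le[of x] le[of "star x"] by (simp add: star_star)
qed

lemma relative_commutantD: "d \<in> relative_commutant B \<Longrightarrow> b \<in> B \<Longrightarrow> b * d = d * b"
  by (simp add: relative_commutant_def)

lemma relative_commutant_star:
  assumes "unital_cstar_subalgebra B" "d \<in> relative_commutant B"
  shows "star d \<in> relative_commutant B"
proof -
  have "b * star d = star d * b" if "b \<in> B" for b
  proof -
    have "star b \<in> B" using assms(1) that by (auto simp: unital_cstar_subalgebra_def)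
    then have "star b * d = d * star b"
      using assms(2) by (auto simp: relative_commutant_def)
    then have "star (star b * d) = star (d * star b)" by simp
    then show ?thesis by (simp add: star_mult star_star)
  qed
  then show ?thesis by (auto simp: relative_commutant_def)
qed

lemma relative_commutant_mult:
  "d \<in> relative_commutant B \<Longrightarrow> e \<in> relative_commutant B \<Longrightarrow> d * e \<in> relative_commutant B"
  by (auto simp: relative_commutant_def) (metis mult.assoc)

lemma relative_commutant_add:
  "d \<in> relative_commutant B \<Longrightarrow> e \<in> relative_commutant B \<Longrightarrow> d + e \<in> relative_commutant B"
  by (auto simp: relative_commutant_def distrib_left distrib_right)

lemma relative_commutant_scaleC:
  "d \<in> relative_commutant B \<Longrightarrow> a *\<^sub>C d \<in> relative_commutant B"
  by (auto simp: relative_commutant_def scaleC_mult_left scaleC_mult_right)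

text \<open>A dense left ideal contains an element \<open>t\<close> with \<open>\<parallel>1 - t\<parallel> < 1\<close>, hence also \<open>1\<close>. A left
  inverse \<open>s\<close> of \<open>t\<close> is a fixed point of \<open>s \<mapsto> 1 + s (1 - t)\<close>, a contraction of the complete set
  \<open>A\<close>.\<close>

lemma one_in_dense_left_ideal:
  fixes A :: "'a::unital_cstar_algebra set"
  assumes A: "unital_cstar_subalgebra A"
    and dense: "closure (cspan S) = A"
    and ideal: "\<And>a s. a \<in> A \<Longrightarrow> s \<in> S \<Longrightarrow> a * s \<in> S"
  shows "1 \<in> cspan S"
proof -
  have A': "csubspace A" "closed A" "1 \<in> A" "\<And>a b. a \<in> A \<Longrightarrow> b \<in> A \<Longrightarrow> a * b \<in> A"
    using A by (auto simp: unital_cstar_subalgebra_def)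
  have "1 \<in> closure (cspan S)" using dense A' by simp
  then obtain t where t: "t \<in> cspan S" "dist t 1 < 1"
    using closure_approachable[of 1 "cspan S"] zero_less_one by blast
  have tA: "t \<in> A" using t(1) dense closure_subset by blast
  define r where "r = 1 - t"
  have rA: "r \<in> A" using A' tA by (simp add: r_def complex_vector.subspace_diff)
  have r: "norm r < 1" using t(2) by (simp add: r_def dist_norm norm_minus_commute)
  have "\<exists>!s\<in>A. 1 + s * r = s"
  proof (rule Banach_fix)
    show "complete A" using A'(2) by (simp add: complete_eq_closed)
    show "(\<lambda>s. 1 + s * r) ` A \<subseteq> A"
      using A' rA by (auto intro!: complex_vector.subspace_add)
    show "dist (1 + x * r) (1 + y * r) \<le> norm r * dist x y" if "x \<in> A" "y \<in> A" for x y
    proof -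
      have "dist (1 + x * r) (1 + y * r) = norm ((x - y) * r)"
        by (simp add: dist_norm left_diff_distrib)
      also have "\<dots> \<le> norm (x - y) * norm r" by (rule norm_mult_ineq)
      finally show ?thesis by (simp add: dist_norm mult.commute)
    qed
  qed (use A' r in auto)
  then obtain s where s: "s \<in> A" "1 + s * r = s" by blast
  have "s * t \<in> cspan S" using t(1)
  proof (induction rule: complex_vector.span_induct_alt)
    case base
    show ?case by (simp add: complex_vector.span_zero)
  next
    case (step c x y)
    then show ?case
      using ideal[OF s(1) step(1)]
      by (simp add: distrib_left scaleC_mult_right complex_vector.span_add
          complex_vector.span_scale complex_vector.span_base)
  qed
  moreover have "s * t = 1" using s(2) by (simp add: r_def algebra_simps)
  ultimately show ?thesis by simp
qed

text \<open>Elements of the span of the values of a pairing are finite sums of values: a scalar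
  coefficient is moved into the argument on which the pairing is complex linear.\<close>

lemma cspan_pairing_sum:
  assumes "t \<in> cspan {g x z |x z. x \<in> X \<and> z \<in> X}"
    and X: "csubspace X"
    and scale: "\<And>c x z. x \<in> X \<Longrightarrow> z \<in> X \<Longrightarrow> \<exists>x'\<in>X. \<exists>z'\<in>X. g x' z' = c *\<^sub>C g x z"
  shows "\<exists>(m::nat) x z. range x \<subseteq> X \<and> range z \<subseteq> X \<and> t = (\<Sum>i<m. g (x i) (z i))"
  using assms(1)
proof (induction rule: complex_vector.span_induct_alt)
  case base
  have "range (\<lambda>_::nat. 0) \<subseteq> X" using X by (auto simp: complex_vector.subspace_0)
  then show ?case by (metis lessThan_0 sum.empty)
next
  case (step c s y)
  obtain m x z where y: "range x \<subseteq> X" "range z \<subseteq> X" "y = (\<Sum>i<(m::nat). g (x i) (z i))"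
    using step by blast
  obtain x' z' where s: "x' \<in> X" "z' \<in> X" "g x' z' = c *\<^sub>C s"
    using step(1) scale by blast
  have "(\<Sum>i<Suc m. g ((x(m := x')) i) ((z(m := z')) i)) = c *\<^sub>C s + y"
    by (simp add: s(3) y(3) add.commute)
  moreover have "range (x(m := x')) \<subseteq> X" "range (z(m := z')) \<subseteq> X"
    using y s by auto
  ultimately show ?case by metis
qed

text \<open>Polarization bounds a sesquilinear form by its values on the diagonal. The Cauchy-Schwarz
  inequality would give a sharper constant, at the price of positivity arguments.\<close>

lemma sesquilinear_bounded_linear:
  fixes S :: "'y::complex_normed_vector \<Rightarrow> 'y \<Rightarrow> 'a::complex_normed_vector"
  assumes add_left: "\<And>y y' z. S (y + y') z = S y z + S y' z"
    and add_right: "\<And>y z z'. S y (z + z') = S y z + S y z'"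
    and scale_left: "\<And>a y z. S (a *\<^sub>C y) z = a *\<^sub>C S y z"
    and scale_right: "\<And>a y z. S y (a *\<^sub>C z) = cnj a *\<^sub>C S y z"
    and diag: "\<And>y. norm (S y y) = (norm y)\<^sup>2"
  shows "bounded_linear (\<lambda>y. S y z)"
proof -
  have bound: "norm (S y z) \<le> 2 * (norm y + norm z)\<^sup>2" for y z
  proof -
    \<comment> \<open>The cases \<open>w = z\<close> and \<open>w = \<i> z\<close> recover \<open>S y z + S z y\<close> and
      \<open>- \<i> (S y z - S z y)\<close>.\<close>
    have part: "norm (S (y + w) (y + w) - S y y - S w w) \<le> 2 * (norm y + norm z)\<^sup>2"
      if "norm w = norm z" for w
    proof -
      have "norm (S (y + w) (y + w) - S y y - S w w)
          \<le> norm (S (y + w) (y + w)) + norm (S y y) + norm (S w w)"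
        by (meson add_right_mono norm_triangle_ineq4 order_trans)
      also have "\<dots> \<le> (norm y + norm z)\<^sup>2 + (norm y)\<^sup>2 + (norm z)\<^sup>2"
        using power_mono[OF norm_triangle_ineq[of y w], of 2] that by (simp add: diag)
      also have "\<dots> \<le> 2 * (norm y + norm z)\<^sup>2"
        by (simp add: power2_sum)
      finally show ?thesis .
    qed
    let ?P = "S (y + z) (y + z) - S y y - S z z"
    let ?Q = "S (y + \<i> *\<^sub>C z) (y + \<i> *\<^sub>C z) - S y y - S (\<i> *\<^sub>C z) (\<i> *\<^sub>C z)"
    have P: "?P = S y z + S z y" by (simp add: add_left add_right)
    have Q: "?Q = (- \<i>) *\<^sub>C S y z + \<i> *\<^sub>C S z y"
      by (simp add: add_left add_right scale_left scale_right scaleC_add_right scaleC_scaleC)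
    have "?P + \<i> *\<^sub>C ?Q = S y z + S y z"
      unfolding P Q
      by (simp add: complex_vector.scale_right_diff_distrib scaleC_add_right scaleC_scaleC)
    then have "2 * norm (S y z) = norm (?P + \<i> *\<^sub>C ?Q)"
      by (metis norm_scaleR abs_numeral scaleR_2)
    also have "\<dots> \<le> norm ?P + norm ?Q"
      using norm_triangle_ineq[of ?P "\<i> *\<^sub>C ?Q"] by (simp add: norm_scaleC)
    also have "\<dots> \<le> 2 * (norm y + norm z)\<^sup>2 + 2 * (norm y + norm z)\<^sup>2"
      by (intro add_mono part) (simp_all add: norm_scaleC)
    finally show ?thesis by simp
  qed
  have scaleR: "S (r *\<^sub>R y) z = r *\<^sub>R S y z" for r y
    by (simp add: scaleR_scaleC scale_left)
  show ?thesis
  proof (rule bounded_linear_intro)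
    show "norm (S y z) \<le> norm y * (2 * (1 + norm z)\<^sup>2)" for y
    proof (cases "y = 0")
      case True
      then show ?thesis using scaleR[of 0 0] by simp
    next
      case False
      have "norm (S (inverse (norm y) *\<^sub>R y) z) \<le> 2 * (1 + norm z)\<^sup>2"
        using bound[of "inverse (norm y) *\<^sub>R y" z] False by simp
      then have "inverse (norm y) * norm (S y z) \<le> 2 * (1 + norm z)\<^sup>2"
        unfolding scaleR by simp
      then show ?thesis using False by (simp add: field_simps)
    qed
  qed (simp_all add: add_left scaleR)
qed


section \<open>The modular automorphism of a bimodule map with a quasi-basis\<close>

lemma bimodule_mapsD:
  assumes "\<phi> \<in> bimodule_maps B"
  shows "\<phi> (x + y) = \<phi> x + \<phi> y" "\<phi> (a *\<^sub>C x) = a *\<^sub>C \<phi> x" "\<phi> (sum f I) = (\<Sum>i\<in>I. \<phi> (f i))"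
    "\<phi> x \<in> B" "b \<in> B \<Longrightarrow> \<phi> (b * x) = b * \<phi> x" "b \<in> B \<Longrightarrow> \<phi> (x * b) = \<phi> x * b"
    "bounded_linear \<phi>" "clinear \<phi>"
  using assms Modules.additive.sum[OF clinear_additive, of \<phi>]
  by (auto simp: bimodule_maps_def clinear_iff)

lemma quasi_basis_of_finite:
  assumes "finite I"
    and "\<And>d. d = (\<Sum>i\<in>I. U i * \<phi> (V i * d))"
    and "\<And>d. d = (\<Sum>i\<in>I. \<phi> (d * U i) * V i)"
  shows "\<exists>m u v. quasi_basis \<phi> m u v"
proof -
  obtain h where h: "bij_betw h {1..card I} I"
    using ex_bij_betw_nat_finite_1[OF assms(1)] by blast
  have "quasi_basis \<phi> (card I) (U \<circ> h) (V \<circ> h)"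
    unfolding quasi_basis_def
    using assms(2,3) sum.reindex_bij_betw[OF h, of "\<lambda>i. U i * \<phi> (V i * _)"]
      sum.reindex_bij_betw[OF h, of "\<lambda>i. \<phi> (_ * U i) * V i"]
    by simp
  then show ?thesis by blast
qed

locale quasi_basis_inclusion =
  fixes B :: "'d::unital_cstar_algebra set" and \<phi> :: "'d \<Rightarrow> 'd"
    and k :: nat and u v :: "nat \<Rightarrow> 'd"
  assumes phi: "\<phi> \<in> bimodule_maps B"
    and qb: "quasi_basis \<phi> k u v"
begin

lemmas phi_simps = bimodule_mapsD[OF phi]

lemma basis_left: "(\<Sum>i=1..k. u i * \<phi> (v i * d)) = d"
  and basis_right: "(\<Sum>i=1..k. \<phi> (d * u i) * v i) = d"
  using qb by (auto simp: quasi_basis_def)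

lemma nondegenerate_right: "(\<And>y. \<phi> (y * d) = \<phi> (y * e)) \<Longrightarrow> d = e"
  by (metis (no_types, lifting) basis_left sum.cong)

lemma nondegenerate_left: "(\<And>y. \<phi> (d * y) = \<phi> (e * y)) \<Longrightarrow> d = e"
  by (metis (no_types, lifting) basis_right sum.cong)

text \<open>Watatani's formula for the modular automorphism and the mirrored formula for its inverse.\<close>

definition theta :: "'d \<Rightarrow> 'd" where "theta d = (\<Sum>i=1..k. u i * \<phi> (d * v i))"

definition theta_inv :: "'d \<Rightarrow> 'd" where "theta_inv d = (\<Sum>i=1..k. \<phi> (u i * d) * v i)"

text \<open>As \<open>x\<close> commutes with the values of \<open>\<phi>\<close>, it can be moved past the coefficients
  \<open>\<phi> (y u\<^sub>i)\<close>; the sum then reassembles \<open>y\<close> to the right of \<open>x\<close>.\<close>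

lemma phi_theta:
  assumes x: "x \<in> relative_commutant B"
  shows "\<phi> (y * theta x) = \<phi> (x * y)"
proof -
  have "\<phi> (y * theta x) = (\<Sum>i=1..k. \<phi> (y * u i) * \<phi> (x * v i))"
    by (simp add: theta_def sum_distrib_left phi_simps flip: mult.assoc)
  also have "\<dots> = (\<Sum>i=1..k. \<phi> (x * (\<phi> (y * u i) * v i)))"
  proof (rule sum.cong[OF refl])
    fix i
    have "\<phi> (y * u i) * x = x * \<phi> (y * u i)"
      using x phi_simps(4) by (auto simp: relative_commutant_def)
    then show "\<phi> (y * u i) * \<phi> (x * v i) = \<phi> (x * (\<phi> (y * u i) * v i))"
      by (metis phi_simps(4,5) mult.assoc)
  qed
  also have "\<dots> = \<phi> (x * y)"
    by (simp add: basis_right del: One_nat_def flip: phi_simps(3) sum_distrib_left)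
  finally show ?thesis .
qed

lemma phi_theta_inv:
  assumes x: "x \<in> relative_commutant B"
  shows "\<phi> (theta_inv x * y) = \<phi> (y * x)"
proof -
  have "\<phi> (theta_inv x * y) = (\<Sum>i=1..k. \<phi> (u i * x) * \<phi> (v i * y))"
    by (simp add: theta_inv_def sum_distrib_right phi_simps mult.assoc)
  also have "\<dots> = (\<Sum>i=1..k. \<phi> (u i * \<phi> (v i * y) * x))"
  proof (rule sum.cong[OF refl])
    fix i
    have "\<phi> (v i * y) * x = x * \<phi> (v i * y)"
      using x phi_simps(4) by (auto simp: relative_commutant_def)
    then show "\<phi> (u i * x) * \<phi> (v i * y) = \<phi> (u i * \<phi> (v i * y) * x)"
      by (metis phi_simps(4,6) mult.assoc)
  qed
  also have "\<dots> = \<phi> (y * x)"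
    by (simp add: basis_left del: One_nat_def flip: phi_simps(3) sum_distrib_right)
  finally show ?thesis .
qed

lemma theta_commutant:
  assumes x: "x \<in> relative_commutant B"
  shows "theta x \<in> relative_commutant B"
  unfolding relative_commutant_def
proof safe
  fix b assume b: "b \<in> B"
  show "b * theta x = theta x * b"
  proof (rule nondegenerate_right)
    fix y
    have "\<phi> (y * (b * theta x)) = \<phi> (x * (y * b))"
      using phi_theta[OF x, of "y * b"] by (simp add: mult.assoc)
    also have "\<dots> = \<phi> (y * (theta x * b))"
      using phi_theta[OF x, of y] b by (simp add: phi_simps flip: mult.assoc)
    finally show "\<phi> (y * (b * theta x)) = \<phi> (y * (theta x * b))" .
  qed
qed

lemma theta_inv_commutant:
  assumes x: "x \<in> relative_commutant B"
  shows "theta_inv x \<in> relative_commutant B"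
  unfolding relative_commutant_def
proof safe
  fix b assume b: "b \<in> B"
  show "b * theta_inv x = theta_inv x * b"
  proof (rule nondegenerate_left)
    fix y
    have "\<phi> (theta_inv x * b * y) = \<phi> (b * y * x)"
      using phi_theta_inv[OF x, of "b * y"] by (simp add: mult.assoc)
    also have "\<dots> = \<phi> (b * theta_inv x * y)"
      using phi_theta_inv[OF x, of y] b by (simp add: phi_simps mult.assoc)
    finally show "\<phi> (b * theta_inv x * y) = \<phi> (theta_inv x * b * y)" by simp
  qed
qed

lemma theta_theta_inv: "x \<in> relative_commutant B \<Longrightarrow> theta (theta_inv x) = x"
  by (rule nondegenerate_right) (simp add: phi_theta phi_theta_inv theta_inv_commutant)

lemma theta_inv_theta: "x \<in> relative_commutant B \<Longrightarrow> theta_inv (theta x) = x"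
  by (rule nondegenerate_left) (simp add: phi_theta phi_theta_inv theta_commutant)

text \<open>Each factor is moved to the right end of the argument of \<open>\<phi>\<close>. The outer factor \<open>x\<close>
  goes first, so its image ends up to the left of the image of \<open>x'\<close>.\<close>

lemma theta_mult:
  assumes "x \<in> relative_commutant B" "x' \<in> relative_commutant B"
  shows "theta (x * x') = theta x * theta x'"
proof (rule nondegenerate_right)
  fix y
  have "\<phi> (y * theta (x * x')) = \<phi> (x * (x' * y))"
    using assms by (simp add: phi_theta relative_commutant_mult mult.assoc)
  also have "\<dots> = \<phi> (x' * (y * theta x))"
    using assms by (simp add: mult.assoc flip: phi_theta)
  also have "\<dots> = \<phi> (y * (theta x * theta x'))"
    using assms(2) by (simp add: mult.assoc flip: phi_theta)
  finally show "\<phi> (y * theta (x * x')) = \<phi> (y * (theta x * theta x'))" .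
qed

lemma theta_iso: "algebra_iso_on (relative_commutant B) (relative_commutant B) theta"
proof -
  have "bij_betw theta (relative_commutant B) (relative_commutant B)"
    by (rule bij_betw_byWitness[where f' = theta_inv])
      (auto simp: theta_theta_inv theta_inv_theta theta_commutant theta_inv_commutant)
  then show ?thesis
    by (simp add: algebra_iso_on_def theta_mult)
      (simp add: theta_def distrib_right distrib_left phi_simps sum.distrib scaleC_mult_left
        scaleC_mult_right scaleC_sum)
qed

lemma modular_automorphism_eq_theta:
  assumes x: "x \<in> relative_commutant B"
  shows "modular_automorphism B \<phi> x = theta x"
proof -
  have "modular_automorphism B \<phi> = restrict theta (relative_commutant B)"
    unfolding modular_automorphism_def
  proof (rule the_equality)
    show "restrict theta (relative_commutant B) \<in> extensional (relative_commutant B) \<and>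
        algebra_iso_on (relative_commutant B) (relative_commutant B)
          (restrict theta (relative_commutant B)) \<and>
        (\<forall>x\<in>relative_commutant B. \<forall>y.
          \<phi> (x * y) = \<phi> (y * restrict theta (relative_commutant B) x))"
      using theta_iso
      by (auto simp: algebra_iso_on_def phi_theta relative_commutant_add
          relative_commutant_mult relative_commutant_scaleC cong: bij_betw_cong)
  next
    fix t
    assume t: "t \<in> extensional (relative_commutant B) \<and>
      algebra_iso_on (relative_commutant B) (relative_commutant B) t \<and>
      (\<forall>x\<in>relative_commutant B. \<forall>y. \<phi> (x * y) = \<phi> (y * t x))"
    show "t = restrict theta (relative_commutant B)"
    proof
      fix x
      show "t x = restrict theta (relative_commutant B) x"
      proof (cases "x \<in> relative_commutant B")
        case True
        have "t x = theta x"
          by (rule nondegenerate_right) (use t True in \<open>auto simp: phi_theta\<close>)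
        with True show ?thesis by simp
      qed (use t in \<open>simp add: extensional_def\<close>)
    qed
  qed
  with x show ?thesis by simp
qed

lemma modular_automorphism_characterization:
  assumes x: "x \<in> relative_commutant B" and w: "\<And>y. \<phi> (x * y) = \<phi> (y * w)"
  shows "modular_automorphism B \<phi> x = w"
  unfolding modular_automorphism_eq_theta[OF x]
  by (rule nondegenerate_right) (simp add: phi_theta[OF x] w)

end


section \<open>Equivalence bimodules\<close>

context equivalence_bimodule
begin

lemma lip_add_right: "lip y (z + z') = lip y z + lip y z'"
  by (metis lip_add_left lip_star star_add)

lemma lip_scaleC_right: "lip y (a *\<^sub>C z) = cnj a *\<^sub>C lip y z"
  by (metis lip_scaleC_left lip_star star_scaleC)

lemma lip_lact_right: "lip y (lact c z) = lip y z * star c"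
  by (metis lip_lact lip_star star_mult)

lemma rip_add_left: "rip (y + y') z = rip y z + rip y' z"
  by (metis rip_add_right rip_star star_add)

lemma rip_scaleC_left: "rip (a *\<^sub>C y) z = cnj a *\<^sub>C rip y z"
  by (metis rip_scaleC_right rip_star star_scaleC)

lemma rip_ract_left: "rip (ract y d) z = star d * rip y z"
  by (metis rip_ract rip_star star_mult)

lemma rip_lact_right: "rip y (lact c z) = rip (lact (star c) y) z"
  by (simp add: rip_lact star_star)

lemma lact_sum_right: "lact c (\<Sum>i\<in>I. f i) = (\<Sum>i\<in>I. lact c (f i))"
  by (rule Modules.additive.sum) (simp add: Modules.additive.intro lact_add_right)

lemma lact_sum_left: "lact (\<Sum>i\<in>I. f i) y = (\<Sum>i\<in>I. lact (f i) y)"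
  by (rule Modules.additive.sum[of "\<lambda>c. lact c y"])
    (simp add: Modules.additive.intro lact_add_left)

lemma ract_sum_left: "ract (\<Sum>i\<in>I. f i) d = (\<Sum>i\<in>I. ract (f i) d)"
  by (rule Modules.additive.sum[of "\<lambda>y. ract y d"])
    (simp add: Modules.additive.intro ract_add_left)

lemma ract_sum_right: "ract y (\<Sum>i\<in>I. f i) = (\<Sum>i\<in>I. ract y (f i))"
  by (rule Modules.additive.sum) (simp add: Modules.additive.intro ract_add_right)

lemma lip_sum_left: "lip (\<Sum>i\<in>I. f i) z = (\<Sum>i\<in>I. lip (f i) z)"
  by (rule Modules.additive.sum[of "\<lambda>y. lip y z"])
    (simp add: Modules.additive.intro lip_add_left)

lemma rip_sum_right: "rip y (\<Sum>i\<in>I. f i) = (\<Sum>i\<in>I. rip y (f i))"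
  by (rule Modules.additive.sum) (simp add: Modules.additive.intro rip_add_right)

lemma bounded_linear_lip: "bounded_linear (\<lambda>y. lip y z)"
  by (rule sesquilinear_bounded_linear)
    (simp_all add: lip_add_left lip_add_right lip_scaleC_left lip_scaleC_right lip_norm)

lemma bounded_linear_rip: "bounded_linear (rip y)"
  using sesquilinear_bounded_linear[of "\<lambda>z y. rip y z" y]
  by (simp add: rip_add_left rip_add_right rip_scaleC_left rip_scaleC_right rip_norm)

lemma bounded_linear_lact: "bounded_linear (\<lambda>c. lact c y)"
proof (rule bounded_linear_intro)
  show "norm (lact c y) \<le> norm c * norm y" for c
  proof (rule power2_le_imp_le)
    have "(norm (lact c y))\<^sup>2 = norm (c * lip y y * star c)"
      by (simp add: lip_lact lip_lact_right mult.assoc flip: lip_norm)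
    also have "\<dots> \<le> norm c * norm (lip y y) * norm (star c)"
      by (meson mult_right_mono norm_ge_zero norm_mult_ineq order_trans)
    also have "\<dots> = (norm c * norm y)\<^sup>2"
      by (simp add: norm_star lip_norm power2_eq_square)
    finally show "(norm (lact c y))\<^sup>2 \<le> (norm c * norm y)\<^sup>2" .
  qed simp
qed (simp_all add: lact_add_left scaleR_scaleC lact_scaleC_left)

lemma bounded_linear_ract: "bounded_linear (ract y)"
proof (rule bounded_linear_intro)
  show "norm (ract y d) \<le> norm d * norm y" for d
  proof (rule power2_le_imp_le)
    have "(norm (ract y d))\<^sup>2 = norm (star d * rip y y * d)"
      by (simp add: rip_ract rip_ract_left mult.assoc flip: rip_norm)
    also have "\<dots> \<le> norm (star d) * norm (rip y y) * norm d"
      by (meson mult_right_mono norm_ge_zero norm_mult_ineq order_trans)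
    also have "\<dots> = (norm d * norm y)\<^sup>2"
      by (simp add: norm_star rip_norm power2_eq_square)
    finally show "(norm (ract y d))\<^sup>2 \<le> (norm d * norm y)\<^sup>2" .
  qed simp
qed (simp_all add: ract_add_right scaleR_scaleC ract_scaleC_right)

end


section \<open>Strong Morita equivalences with finite frames\<close>

text \<open>In the unital case a strong Morita equivalence of inclusions is witnessed by two finite
  families in \<open>X\<close>, one resolving the unit of \<open>C\<close>, the other the unit of \<open>D\<close>. All later
  arguments use these families in place of the density conditions.\<close>

locale framed_inclusion = equivalence_bimodule lact ract lip rip
  for lact :: "'c::unital_cstar_algebra \<Rightarrow> 'y::{complex_normed_vector,banach} \<Rightarrow> 'y"
    and ract :: "'y \<Rightarrow> 'd::unital_cstar_algebra \<Rightarrow> 'y"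
    and lip rip +
  fixes A :: "'c set" and B :: "'d set" and X :: "'y set"
    and m :: nat and xl zl :: "nat \<Rightarrow> 'y"
    and n :: nat and xr zr :: "nat \<Rightarrow> 'y"
  assumes A: "unital_cstar_subalgebra A"
    and B: "unital_cstar_subalgebra B"
    and X: "csubspace X"
    and lact_X: "a \<in> A \<Longrightarrow> x \<in> X \<Longrightarrow> lact a x \<in> X"
    and ract_X: "b \<in> B \<Longrightarrow> x \<in> X \<Longrightarrow> ract x b \<in> X"
    and lip_X: "x \<in> X \<Longrightarrow> z \<in> X \<Longrightarrow> lip x z \<in> A"
    and rip_X: "x \<in> X \<Longrightarrow> z \<in> X \<Longrightarrow> rip x z \<in> B"
    and frame_X: "xl i \<in> X" "zl i \<in> X" "xr i \<in> X" "zr i \<in> X"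
    and left_frame: "(\<Sum>i<m. lip (xl i) (zl i)) = 1"
    and right_frame: "(\<Sum>i<n. rip (xr i) (zr i)) = 1"

lemma strongly_Morita_equivalent_imp_framed:
  assumes A: "unital_cstar_subalgebra A"
    and B: "unital_cstar_subalgebra B"
    and "strongly_Morita_equivalent_wrt A B lact ract lip rip X"
  obtains m xl zl n xr zr where
    "framed_inclusion lact ract lip rip A B X m xl zl n xr zr"
proof -
  have eb: "equivalence_bimodule lact ract lip rip"
    and X: "csubspace X"
    and lact_X: "\<And>a x. a \<in> A \<Longrightarrow> x \<in> X \<Longrightarrow> lact a x \<in> X"
    and ract_X: "\<And>b x. b \<in> B \<Longrightarrow> x \<in> X \<Longrightarrow> ract x b \<in> X"
    and ip_X: "\<And>x z. x \<in> X \<Longrightarrow> z \<in> X \<Longrightarrow> lip x z \<in> A \<and> rip x z \<in> B"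
    and dA: "closure (cspan {lip x z |x z. x \<in> X \<and> z \<in> X}) = A"
    and dB: "closure (cspan {rip x z |x z. x \<in> X \<and> z \<in> X}) = B"
    using assms(3) by (auto simp: strongly_Morita_equivalent_wrt_def)
  interpret equivalence_bimodule lact ract lip rip by (rule eb)
  have "1 \<in> cspan {lip x z |x z. x \<in> X \<and> z \<in> X}"
  proof (rule one_in_dense_left_ideal[OF A dA])
    fix a s assume "a \<in> A" "s \<in> {lip x z |x z. x \<in> X \<and> z \<in> X}"
    then show "a * s \<in> {lip x z |x z. x \<in> X \<and> z \<in> X}"
      using lact_X by clarsimp (metis lip_lact)
  qed
  then obtain m xl zl where l: "range xl \<subseteq> X" "range zl \<subseteq> X"
      "1 = (\<Sum>i<(m::nat). lip (xl i) (zl i))"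
    using cspan_pairing_sum[OF _ X, of 1 lip] X
    by (metis lip_scaleC_left complex_vector.subspace_scale)
  have "1 \<in> cspan {rip x z |x z. x \<in> X \<and> z \<in> X}"
  proof (rule one_in_dense_left_ideal[OF B dB])
    fix b s assume b: "b \<in> B" and "s \<in> {rip x z |x z. x \<in> X \<and> z \<in> X}"
    moreover have "b * rip x z = rip (ract x (star b)) z" for x z
      by (simp add: rip_ract_left star_star)
    moreover have "star b \<in> B" using B b by (simp add: unital_cstar_subalgebra_def)
    ultimately show "b * s \<in> {rip x z |x z. x \<in> X \<and> z \<in> X}"
      using ract_X by blast
  qed
  then obtain n xr zr where r: "range xr \<subseteq> X" "range zr \<subseteq> X"
      "1 = (\<Sum>i<(n::nat). rip (xr i) (zr i))"
    using cspan_pairing_sum[OF _ X, of 1 rip] X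
    by (metis rip_scaleC_right complex_vector.subspace_scale)
  have "framed_inclusion lact ract lip rip A B X m xl zl n xr zr"
    by unfold_locales (use A B X lact_X ract_X ip_X l r in auto)
  then show thesis by (rule that)
qed

context framed_inclusion
begin

lemma star_A: "a \<in> A \<Longrightarrow> star a \<in> A"
  and sum_A: "(\<And>i. i \<in> I \<Longrightarrow> f i \<in> A) \<Longrightarrow> (\<Sum>i\<in>I. f i) \<in> A"
  using A B by (auto simp: unital_cstar_subalgebra_def complex_vector.subspace_sum)

lemma left_reconstruction: "(\<Sum>i<m. ract (xl i) (rip (zl i) y)) = y"
  by (simp add: left_frame lact_one flip: lip_rip lact_sum_left)

text \<open>Although \<open>X\<close> is only a subspace of \<open>Y\<close>, it is large enough to be faithful for both big
  algebras and to separate the points of \<open>Y\<close>, because the frames lie in \<open>X\<close>.\<close>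

lemma lact_faithful: "(\<And>x. x \<in> X \<Longrightarrow> lact c x = lact c' x) \<Longrightarrow> c = c'"
proof -
  assume eq: "\<And>x. x \<in> X \<Longrightarrow> lact c x = lact c' x"
  have "c * 1 = c' * 1"
    unfolding left_frame[symmetric]
    by (simp add: sum_distrib_left eq frame_X flip: lip_lact)
  then show ?thesis by simp
qed

lemma ract_faithful: "(\<And>x. x \<in> X \<Longrightarrow> ract x d = ract x d') \<Longrightarrow> d = d'"
proof -
  assume eq: "\<And>x. x \<in> X \<Longrightarrow> ract x d = ract x d'"
  have "1 * d = 1 * d'"
    unfolding right_frame[symmetric]
    by (simp add: sum_distrib_right eq frame_X flip: rip_ract)
  then show ?thesis by simp
qed

lemma rip_separates: "(\<And>x. x \<in> X \<Longrightarrow> rip x y = rip x y') \<Longrightarrow> y = y'"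
proof -
  assume "\<And>x. x \<in> X \<Longrightarrow> rip x y = rip x y'"
  then have "(\<Sum>i<m. ract (xl i) (rip (zl i) y)) = (\<Sum>i<m. ract (xl i) (rip (zl i) y'))"
    by (simp add: frame_X)
  then show ?thesis by (simp add: left_reconstruction)
qed


subsection \<open>The isomorphism of relative commutants\<close>

text \<open>Right multiplication by \<open>d \<in> B' \<inter> D\<close> on \<open>X\<close> is \<open>B\<close>-linear, so it is left multiplication
  by an element of \<open>C\<close>, which the left frame computes; \<open>rho_inv\<close> is the mirror image.\<close>

definition rho :: "'d \<Rightarrow> 'c" where "rho d = (\<Sum>i<m. lip (ract (xl i) d) (zl i))"

definition rho_inv :: "'c \<Rightarrow> 'd" where "rho_inv c = (\<Sum>j<n. rip (xr j) (lact c (zr j)))"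

lemma rho_lact:
  assumes "d \<in> relative_commutant B" "x \<in> X"
  shows "lact (rho d) x = ract x d"
proof -
  have "lact (rho d) x = (\<Sum>i<m. ract (xl i) (d * rip (zl i) x))"
    by (simp add: rho_def lact_sum_left lip_rip ract_mult)
  also have "\<dots> = (\<Sum>i<m. ract (xl i) (rip (zl i) x * d))"
    by (simp add: relative_commutantD[OF assms(1)] rip_X assms(2) frame_X)
  also have "\<dots> = ract x d"
    by (simp add: ract_mult left_reconstruction flip: ract_sum_left)
  finally show ?thesis .
qed

lemma rho_commutant:
  assumes d: "d \<in> relative_commutant B"
  shows "rho d \<in> relative_commutant A"
  unfolding relative_commutant_def
proof safe
  fix a assume "a \<in> A"
  then show "a * rho d = rho d * a"
    by (intro lact_faithful) (simp add: lact_mult rho_lact[OF d] lact_X lact_ract)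
qed

lemma rho_inv_ract:
  assumes "c \<in> relative_commutant A" "x \<in> X"
  shows "ract x (rho_inv c) = lact c x"
proof -
  have "ract x (rho_inv c) = (\<Sum>j<n. lact (lip x (xr j) * c) (zr j))"
    by (simp add: rho_inv_def ract_sum_right lact_mult flip: lip_rip)
  also have "\<dots> = (\<Sum>j<n. lact (c * lip x (xr j)) (zr j))"
    by (simp add: relative_commutantD[OF assms(1)] lip_X assms(2) frame_X)
  also have "\<dots> = lact c x"
    by (simp add: lact_mult lip_rip right_frame ract_one flip: lact_sum_right ract_sum_right)
  finally show ?thesis .
qed

lemma rho_inv_commutant:
  assumes c: "c \<in> relative_commutant A"
  shows "rho_inv c \<in> relative_commutant B"
  unfolding relative_commutant_def
proof safe
  fix b assume "b \<in> B"
  then show "b * rho_inv c = rho_inv c * b"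
    by (intro ract_faithful) (simp add: ract_mult rho_inv_ract[OF c] ract_X lact_ract)
qed

text \<open>The adjoint of \<open>rho d\<close> is tested against \<open>rip w\<close> with \<open>w \<in> X\<close>. The factor \<open>star d\<close> comes
  out on the left of \<open>rip w x \<in> B\<close> and has to pass to its right, where it acts on \<open>x\<close>.\<close>

lemma rho_star:
  assumes d: "d \<in> relative_commutant B"
  shows "rho (star d) = star (rho d)"
proof (rule lact_faithful)
  fix x assume x: "x \<in> X"
  have d': "star d \<in> relative_commutant B" by (rule relative_commutant_star[OF B d])
  show "lact (rho (star d)) x = lact (star (rho d)) x"
  proof (rule rip_separates)
    fix w assume w: "w \<in> X"
    have "rip w (lact (star (rho d)) x) = star d * rip w x"
      by (simp add: rho_lact[OF d w] rip_ract_left flip: rip_lact)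
    also have "\<dots> = rip w x * star d"
      using d' rip_X[OF w x] by (auto simp: relative_commutant_def)
    also have "\<dots> = rip w (lact (rho (star d)) x)"
      by (simp add: rho_lact[OF d' x] rip_ract)
    finally show "rip w (lact (rho (star d)) x) = rip w (lact (star (rho d)) x)" by simp
  qed
qed

lemma rho_iso: "cstar_iso_on (relative_commutant B) (relative_commutant A) rho"
proof -
  have "rho_inv (rho d) = d" if "d \<in> relative_commutant B" for d
    by (rule ract_faithful) (simp add: that rho_inv_ract rho_commutant rho_lact)
  moreover have "rho (rho_inv c) = c" if "c \<in> relative_commutant A" for c
    by (rule lact_faithful) (simp add: that rho_inv_ract rho_inv_commutant rho_lact)
  ultimately have "bij_betw rho (relative_commutant B) (relative_commutant A)"
    by (intro bij_betw_byWitness[where f' = rho_inv])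
      (auto simp: rho_commutant rho_inv_commutant)
  moreover have "rho (d * e) = rho d * rho e"
    if "d \<in> relative_commutant B" "e \<in> relative_commutant B" for d e
    by (rule lact_faithful)
      (simp add: that rho_lact relative_commutant_mult ract_mult lact_mult flip: lact_ract)
  ultimately show ?thesis
    by (simp add: cstar_iso_on_def algebra_iso_on_def rho_star)
      (simp add: rho_def ract_add_right ract_scaleC_right lip_add_left lip_scaleC_left
        sum.distrib scaleC_sum)
qed

end


section \<open>The induced bimodule map\<close>

locale framed_bimodule_map = framed_inclusion lact ract lip rip A B X m xl zl n xr zr
  for lact :: "'c::unital_cstar_algebra \<Rightarrow> 'y::{complex_normed_vector,banach} \<Rightarrow> 'y"
    and ract :: "'y \<Rightarrow> 'd::unital_cstar_algebra \<Rightarrow> 'y"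
    and lip rip A B X m xl zl n xr zr +
  fixes \<phi> :: "'d \<Rightarrow> 'd"
  assumes phi: "\<phi> \<in> bimodule_maps B"
begin

lemmas phi_simps = bimodule_mapsD[OF phi]

definition tau :: "'y \<Rightarrow> 'y" where "tau y = (\<Sum>i<m. ract (xl i) (\<phi> (rip (zl i) y)))"

definition psi :: "'c \<Rightarrow> 'c" where "psi c = (\<Sum>i<m. lip (tau (lact c (xl i))) (zl i))"

lemma tau_X: "tau y \<in> X"
  unfolding tau_def
  by (rule complex_vector.subspace_sum[OF X]) (simp add: ract_X phi_simps frame_X)

lemma rip_tau:
  assumes "x \<in> X"
  shows "rip x (tau y) = \<phi> (rip x y)"
proof -
  have "rip x (tau y) = \<phi> (\<Sum>i<m. rip x (xl i) * rip (zl i) y)"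
    by (simp add: tau_def rip_sum_right rip_ract phi_simps rip_X assms frame_X)
  also have "\<dots> = \<phi> (rip x y)"
    by (simp add: left_reconstruction flip: rip_ract rip_sum_right)
  finally show ?thesis .
qed

lemma tau_eqI:
  assumes "\<And>x. x \<in> X \<Longrightarrow> rip x w = \<phi> (rip x y)"
  shows "tau y = w"
  by (rule rip_separates) (simp add: rip_tau assms)

lemma tau_clinear: "clinear tau"
  by (simp add: clinear_iff tau_def rip_add_right rip_scaleC_right phi_simps ract_add_right
      ract_scaleC_right sum.distrib scaleC_sum)

lemma tau_sum: "tau (sum f I) = (\<Sum>i\<in>I. tau (f i))"
  by (rule Modules.additive.sum[OF clinear_additive[OF tau_clinear]])

lemma tau_bounded: "bounded_linear tau"
  unfolding tau_def
  by (intro bounded_linear_sum bounded_linear_compose[OF bounded_linear_ract]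
      bounded_linear_compose[OF phi_simps(7)] bounded_linear_rip)

lemma tau_lact: "a \<in> A \<Longrightarrow> tau (lact a y) = lact a (tau y)"
  by (rule tau_eqI) (simp add: rip_lact_right rip_tau lact_X star_A)

lemma tau_ract: "b \<in> B \<Longrightarrow> tau (ract y b) = ract (tau y) b"
  by (rule tau_eqI) (simp add: rip_ract rip_tau phi_simps)

lemma tau_map_eq: "tau_map rip X \<phi> = tau"
  unfolding tau_map_def
proof (rule the_equality)
  fix t assume "clinear t \<and> range t \<subseteq> X \<and> (\<forall>x\<in>X. \<forall>y. rip x (t y) = \<phi> (rip x y))"
  then show "t = tau" by (intro ext tau_eqI[symmetric]) simp
qed (use tau_clinear tau_X rip_tau in auto)

lemma psi_lact:
  assumes "x \<in> X"
  shows "lact (psi c) x = tau (lact c x)"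
proof -
  have "lact (psi c) x = tau (\<Sum>i<m. ract (lact c (xl i)) (rip (zl i) x))"
    by (simp add: psi_def lact_sum_left lip_rip tau_sum tau_ract rip_X assms frame_X)
  also have "\<dots> = tau (lact c x)"
    by (simp add: lact_ract left_reconstruction flip: lact_sum_right)
  finally show ?thesis .
qed

lemma psi_A: "psi c \<in> A"
  unfolding psi_def by (intro sum_A lip_X tau_X frame_X)

lemma psi_clinear: "clinear psi"
  using tau_clinear
  by (simp add: clinear_iff psi_def lact_add_left lact_scaleC_left lip_add_left lip_scaleC_left
      sum.distrib scaleC_sum)

lemma f_map_eq: "f_map A lact rip X \<phi> = psi"
  unfolding f_map_def tau_map_eq
proof (rule the_equality)
  fix f assume "clinear f \<and> range f \<subseteq> A \<and> (\<forall>c. \<forall>x\<in>X. lact (f c) x = tau (lact c x))"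
  then show "f = psi" by (intro ext lact_faithful) (simp add: psi_lact)
qed (use psi_clinear psi_A psi_lact in auto)

lemma psi_bimodule_map: "psi \<in> bimodule_maps A"
proof -
  have "psi (a * c) = a * psi c" if "a \<in> A" for a c
    by (rule lact_faithful) (simp add: psi_lact lact_mult tau_lact that)
  moreover have "psi (c * a) = psi c * a" if "a \<in> A" for a c
    by (rule lact_faithful) (simp add: psi_lact lact_mult lact_X that)
  moreover have "bounded_linear psi"
    unfolding psi_def
    by (intro bounded_linear_sum bounded_linear_compose[OF bounded_linear_lip]
        bounded_linear_compose[OF tau_bounded] bounded_linear_lact)
  ultimately show ?thesis
    using psi_clinear psi_A by (auto simp: bimodule_maps_def)
qed

lemma psi_lip:
  assumes "x \<in> X"
  shows "psi (lip y x) = lip (tau y) x"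
  by (rule lact_faithful) (simp add: psi_lact lip_rip tau_ract rip_X assms)

text \<open>A quasi-basis \<open>(u\<^sub>k, v\<^sub>k)\<close> of \<open>\<phi>\<close> is carried over by placing each \<open>u\<^sub>k\<close> and
  \<open>v\<^sub>k\<close> between frame elements: the pairs \<open>(lip (x\<^sub>i u\<^sub>k) x'\<^sub>j, lip (z'\<^sub>j v\<^sub>k) z\<^sub>i)\<close>, for all
  \<open>i, j, k\<close>. Summation over \<open>j\<close> and \<open>i\<close> collapses both frames, so that only the quasi-basis
  identities of \<open>\<phi>\<close> remain.\<close>

lemma psi_quasi_basis:
  assumes "quasi_basis \<phi> k u v"
  shows "\<exists>k' u' v'. quasi_basis psi k' u' v'"
proof -
  interpret Q: quasi_basis_inclusion B \<phi> k u v
    using phi assms by unfold_locales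
  define I where "I = {..<m} \<times> {1..k} \<times> {..<n}"
  define U where "U = (\<lambda>(i, l, j). lip (ract (xl i) (u l)) (xr j))"
  define V where "V = (\<lambda>(i, l, j). lip (ract (zr j) (v l)) (zl i))"
  have sum_I: "(\<Sum>t\<in>I. f t) = (\<Sum>i<m. \<Sum>l=1..k. \<Sum>j<n. f (i, l, j))"
    for f :: "_ \<Rightarrow> 'e::comm_monoid_add"
    by (simp add: I_def sum.cartesian_product)
  have first: "(\<Sum>t\<in>I. U t * psi (V t * c)) = c" for c
  proof (rule lact_faithful)
    fix x assume x: "x \<in> X"
    define y where "y = lact c x"
    \<comment> \<open>The right frame absorbs \<open>d\<close>, which lies outside \<open>B\<close> in general and cannot leave \<open>\<phi>\<close>
      directly.\<close>
    have inner: "(\<Sum>j<n. rip (xr j) (tau (lact (lip (ract (zr j) d) w) y))) = \<phi> (d * rip w y)"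
      for d w
    proof -
      have "(\<Sum>j<n. rip (xr j) (tau (lact (lip (ract (zr j) d) w) y)))
          = \<phi> ((\<Sum>j<n. rip (xr j) (zr j)) * (d * rip w y))"
        by (simp add: rip_tau frame_X lip_rip rip_ract phi_simps sum_distrib_right mult.assoc)
      then show ?thesis by (simp add: right_frame)
    qed
    have "lact (\<Sum>t\<in>I. U t * psi (V t * c)) x = (\<Sum>t\<in>I. lact (U t) (tau (lact (V t) y)))"
      by (simp add: lact_sum_left lact_mult psi_lact x y_def)
    also have "\<dots> = (\<Sum>i<m. \<Sum>l=1..k. \<Sum>j<n.
        ract (ract (xl i) (u l)) (rip (xr j) (tau (lact (lip (ract (zr j) (v l)) (zl i)) y))))"
      by (simp add: sum_I U_def V_def lip_rip)
    also have "\<dots> = (\<Sum>i<m. \<Sum>l=1..k. ract (xl i) (u l * \<phi> (v l * rip (zl i) y)))"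
      by (simp add: inner ract_mult flip: ract_sum_right)
    also have "\<dots> = (\<Sum>i<m. ract (xl i) (rip (zl i) y))"
      by (simp add: Q.basis_left del: One_nat_def flip: ract_sum_right)
    also have "\<dots> = lact c x" by (simp add: left_reconstruction y_def)
    finally show "lact (\<Sum>t\<in>I. U t * psi (V t * c)) x = lact c x" .
  qed
  have second: "(\<Sum>t\<in>I. psi (c * U t) * V t) = c" for c
  proof -
    \<comment> \<open>The second quasi-basis identity of \<open>\<phi>\<close>, lifted from \<open>D\<close> to \<open>Y\<close>.\<close>
    have inner: "(\<Sum>l=1..k. ract (tau (ract y (u l))) (v l)) = y" for y
    proof -
      have "(\<Sum>l=1..k. ract (tau (ract y (u l))) (v l))
          = (\<Sum>l=1..k. \<Sum>i<m. ract (xl i) (\<phi> (rip (zl i) y * u l) * v l))"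
        by (simp add: tau_def ract_sum_left rip_ract ract_mult)
      also have "\<dots> = (\<Sum>i<m. ract (xl i) (\<Sum>l=1..k. \<phi> (rip (zl i) y * u l) * v l))"
        by (subst sum.swap) (simp add: ract_sum_right)
      also have "\<dots> = y"
        by (simp add: Q.basis_right left_reconstruction del: One_nat_def)
      finally show ?thesis .
    qed
    have "(\<Sum>t\<in>I. psi (c * U t) * V t) = (\<Sum>i<m. \<Sum>l=1..k. \<Sum>j<n.
        lip (ract (tau (ract (lact c (xl i)) (u l))) (rip (xr j) (zr j) * v l)) (zl i))"
      by (simp add: sum_I U_def V_def psi_lip frame_X lip_rip rip_ract ract_mult lact_ract
          flip: lip_lact)
    also have "\<dots> = (\<Sum>i<m. \<Sum>l=1..k.
        lip (ract (tau (ract (lact c (xl i)) (u l))) (v l)) (zl i))"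
      by (simp add: right_frame flip: lip_sum_left ract_sum_right sum_distrib_right)
    also have "\<dots> = (\<Sum>i<m. lip (lact c (xl i)) (zl i))"
      by (simp add: inner del: One_nat_def flip: lip_sum_left)
    also have "\<dots> = c"
      by (simp add: lip_lact left_frame flip: sum_distrib_left)
    finally show ?thesis .
  qed
  show ?thesis
    by (rule quasi_basis_of_finite[of I U psi V]) (simp add: I_def, simp_all add: first second)
qed

text \<open>On \<open>X\<close>, both sides are computed by \<open>tau\<close>, where \<open>rho\<close> turns left into right
  multiplication; the modular identity of \<open>\<phi>\<close> then applies to inner products.\<close>

lemma psi_modular:
  assumes d: "d \<in> relative_commutant B" and e: "e \<in> relative_commutant B"
    and modular: "\<And>y. \<phi> (d * y) = \<phi> (y * e)"
  shows "psi (rho d * c) = psi (c * rho e)"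
proof (rule lact_faithful)
  fix x assume x: "x \<in> X"
  have d': "star d \<in> relative_commutant B" by (rule relative_commutant_star[OF B d])
  define y where "y = lact c x"
  have "tau (lact (rho d) y) = tau (ract y e)"
  proof (rule tau_eqI)
    fix w assume w: "w \<in> X"
    have "rip w (lact (rho d) y) = d * rip w y"
      by (simp add: rip_lact_right rho_lact[OF d' w] rip_ract_left star_star flip: rho_star[OF d])
    then show "rip w (tau (ract y e)) = \<phi> (rip w (lact (rho d) y))"
      by (simp add: rip_tau w rip_ract modular)
  qed
  then show "lact (psi (rho d * c)) x = lact (psi (c * rho e)) x"
    by (simp add: psi_lact x lact_mult rho_lact[OF e x] y_def lact_ract)
qed

end


section \<open>Strong Morita equivalence and modular automorphisms\<close>

theorem theorem8p4:
  fixes A :: "'c::unital_cstar_algebra set"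
    and B :: "'d::unital_cstar_algebra set"
    and lact :: "'c \<Rightarrow> 'y::{complex_normed_vector,banach} \<Rightarrow> 'y"
    and ract :: "'y \<Rightarrow> 'd \<Rightarrow> 'y"
    and lip :: "'y \<Rightarrow> 'y \<Rightarrow> 'c"
    and rip :: "'y \<Rightarrow> 'y \<Rightarrow> 'd"
    and X :: "'y set"
    and \<phi> :: "'d \<Rightarrow> 'd"
  assumes "unital_cstar_subalgebra A"
    and "unital_cstar_subalgebra B"
    and "strongly_Morita_equivalent_wrt A B lact ract lip rip X"
    and "\<phi> \<in> bimodule_maps B"
    and "\<exists>m u v. quasi_basis \<phi> m u v"
  shows "f_map A lact rip X \<phi> \<in> bimodule_maps A \<and>
    (\<exists>m u v. quasi_basis (f_map A lact rip X \<phi>) m u v) \<and>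
    (\<exists>\<rho>. cstar_iso_on (relative_commutant B) (relative_commutant A) \<rho> \<and>
      (\<forall>c\<in>relative_commutant A.
        modular_automorphism A (f_map A lact rip X \<phi>) c =
        \<rho> (modular_automorphism B \<phi> (inv_into (relative_commutant B) \<rho> c))))"
proof -
  obtain k u v where qb: "quasi_basis \<phi> k u v" using assms(5) by blast
  obtain m xl zl n xr zr where "framed_inclusion lact ract lip rip A B X m xl zl n xr zr"
    using strongly_Morita_equivalent_imp_framed[OF assms(1-3)] .
  then interpret framed_inclusion lact ract lip rip A B X m xl zl n xr zr .
  interpret framed_bimodule_map lact ract lip rip A B X m xl zl n xr zr \<phi>
    using assms(4) by unfold_locales
  interpret Q: quasi_basis_inclusion B \<phi> k u v
    using phi qb by unfold_locales
  obtain k' u' v' where qb': "quasi_basis psi k' u' v'"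
    using psi_quasi_basis[OF qb] by blast
  interpret P: quasi_basis_inclusion A psi k' u' v'
    using psi_bimodule_map qb' by unfold_locales
  have bij: "bij_betw rho (relative_commutant B) (relative_commutant A)"
    using rho_iso by (simp add: cstar_iso_on_def algebra_iso_on_def)
  have "modular_automorphism A psi c =
      rho (modular_automorphism B \<phi> (inv_into (relative_commutant B) rho c))"
    if c: "c \<in> relative_commutant A" for c
  proof -
    define d where "d = inv_into (relative_commutant B) rho c"
    have d: "d \<in> relative_commutant B" "rho d = c"
      using bij c unfolding d_def by (auto simp: bij_betw_def inv_into_into f_inv_into_f)
    have "modular_automorphism A psi c = rho (Q.theta d)"
    proof (rule P.modular_automorphism_characterization[OF c])
      show "psi (c * y) = psi (y * rho (Q.theta d))" for y
        using psi_modular[OF d(1) Q.theta_commutant[OF d(1)]] d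
        by (simp add: Q.phi_theta)
    qed
    then show ?thesis
      by (simp add: Q.modular_automorphism_eq_theta[OF d(1)] flip: d_def)
  qed
  then show ?thesis
    unfolding f_map_eq using psi_bimodule_map qb' rho_iso by blast
qed

end
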